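(* Let $\mathbf{v}=(v_1,\ldots,v_n)$ and $\mathbf{w}=(w_1,\ldots,w_n)$ be vectors in $\mathbb{R}^n$. If $k \geq 1$ is an integer, then \[ \|\mathbf{v}\|^{2k}\|\mathbf{w}\|^{2k} - \langle \mathbf{v},\mathbf{w}\rangle^{2k} = \frac{1}{2}\sum_{\substack{a_1 + \cdots + a_n = k\\ b_1 + \cdots + b_n = k}}\binom{k}{a_1, a_2, \ldots, a_n}\binom{k}{b_1, b_2, \ldots, b_n}\left(\prod_{i = 1}^{n} v_i^{a_i}w_i^{b_i} - \prod_{i = 1}^{n} v_i^{b_i}w_i^{a_i}\right)^2, \] where the sum is over all $n$-tuples of integers $(a_1, \ldots, a_n)$ and $(b_1, \ldots, b_n)$ satisfying $a_i,b_i \geq 0$ for all $1 \leq i \leq n$ and $a_1 + \cdots + a_n = b_1 + \cdots + b_n = k$.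
   Context: $\langle\cdot,\cdot\rangle$ and $\|\cdot\|$ are the usual dot product and Euclidean norm on $\mathbb{R}^n$. $\binom{k}{a_1,\ldots,a_n}=\frac{k!}{a_1!\cdots a_n!}$ is the multinomial coefficient, and $0^0=1$. *)

theory Defs
  imports "HOL-Analysis.Analysis"
begin

(* A tuple (a_1, ..., a_n) is a function on the finite index type 'n of real ^ 'n. *)
definition weak_compositions :: "nat \<Rightarrow> ('n::finite \<Rightarrow> nat) set" where
  "weak_compositions k = {a. (\<Sum>i\<in>UNIV. a i) = k}"

definition multinomial :: "nat \<Rightarrow> ('n::finite \<Rightarrow> nat) \<Rightarrow> real" where
  "multinomial k a = fact k / (\<Prod>i\<in>UNIV. fact (a i))"

(* Sums over an infinite set are 0 by convention, so finiteness matters here. *)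
lemma finite_weak_compositions: "finite (weak_compositions k :: ('n::finite \<Rightarrow> nat) set)"
proof (rule finite_subset)
  show "(weak_compositions k :: ('n \<Rightarrow> nat) set) \<subseteq> PiE UNIV (\<lambda>_. {..k})"
  proof
    fix a :: "'n \<Rightarrow> nat"
    assume "a \<in> weak_compositions k"
    then have "a i \<le> k" for i
      using member_le_sum[of i UNIV a] by (simp add: weak_compositions_def)
    then show "a \<in> PiE UNIV (\<lambda>_. {..k})"
      by (simp add: PiE_UNIV_domain)
  qed
qed (simp add: finite_PiE)

end

theory Submission
  imports Defs
begin

text \<open>
  The identity is Lagrange's identity for symmetric tensors of degree \<open>k\<close>.  Send a vector \<open>x\<close> to the
  family of its monomials \<open>\<Prod>i. x\<^sub>i ^ a i\<close>, indexed by the weak compositions \<open>a\<close> of \<open>k\<close>, and weight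
  the monomial of exponent \<open>a\<close> by the multinomial coefficient of \<open>a\<close>.  By the multinomial theorem,
  the weighted inner product of the families of \<open>v\<close> and \<open>w\<close> is \<open>\<Sum>i. v\<^sub>i w\<^sub>i\<close> raised to the power
  \<open>k\<close>, so inner products are raised to the power \<open>k\<close> and squared norms likewise.  Lagrange's
  identity for weighted sums (\<open>weighted_Lagrange_identity\<close>), applied to these two families,
  is then the claim.

  The multinomial theorem follows by induction on the set of variables
  (\<open>divided_power_sum\<close>): after division by \<open>k!\<close>, adding one more variable is just the
  binomial theorem.
\<close>

text \<open>
  Written with divided powers \<open>x ^ k / k!\<close>, the multinomial theorem has no coefficients.
  Exponents outside \<open>S\<close> are pinned to \<open>0\<close> so that each exponent function on \<open>S\<close> is counted once;
  then an exponent function on \<open>insert s S\<close> splits uniquely into its value \<open>j\<close> at \<open>s\<close> and an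
  exponent function on \<open>S\<close> of total degree \<open>k - j\<close>.
\<close>
lemma divided_power_sum:
  fixes x :: "'a \<Rightarrow> real"
  assumes "finite S"
  shows "(\<Sum>i\<in>S. x i) ^ k / fact k =
    (\<Sum>a | (\<forall>i. i \<notin> S \<longrightarrow> a i = 0) \<and> (\<Sum>i\<in>S. a i) = k. \<Prod>i\<in>S. x i ^ a i / fact (a i))"
  using assms
proof (induction S arbitrary: k rule: finite_induct)
  case empty
  have "{a :: 'a \<Rightarrow> nat. \<forall>i. a i = 0} = {\<lambda>_. 0}"
    by auto
  then show ?case
    by (cases "k = 0") auto
next
  case (insert s S)
  define C where "C T m = {a :: 'a \<Rightarrow> nat. (\<forall>i. i \<notin> T \<longrightarrow> a i = 0) \<and> (\<Sum>i\<in>T. a i) = m}" for T m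
  have upd: "(\<Sum>i\<in>S. (a(s := j)) i) = (\<Sum>i\<in>S. a i)" for a :: "'a \<Rightarrow> nat" and j
    using insert.hyps by (intro sum.cong) auto
  have "(\<Sum>i\<in>insert s S. x i) ^ k / fact k =
      (\<Sum>j\<le>k. of_nat (k choose j) * x s ^ j * (\<Sum>i\<in>S. x i) ^ (k - j)) / fact k"
    using insert.hyps by (simp add: binomial_ring)
  also have "\<dots> = (\<Sum>j\<le>k. x s ^ j / fact j * ((\<Sum>i\<in>S. x i) ^ (k - j) / fact (k - j)))"
    unfolding sum_divide_distrib
    by (intro sum.cong refl) (simp add: binomial_fact field_simps)
  also have "\<dots> = (\<Sum>j\<le>k. \<Sum>a\<in>C S (k - j). x s ^ j / fact j * (\<Prod>i\<in>S. x i ^ a i / fact (a i)))"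
    by (simp only: insert.IH C_def sum_distrib_left)
  also have "\<dots> = (\<Sum>(j, a)\<in>(SIGMA j:{..k}. C S (k - j)).
      x s ^ j / fact j * (\<Prod>i\<in>S. x i ^ a i / fact (a i)))"
  proof (rule sum.Sigma)
    have "C S m \<subseteq> {a. \<forall>i. (i \<in> S \<longrightarrow> a i \<in> {..m}) \<and> (i \<notin> S \<longrightarrow> a i = 0)}" for m
      using insert.hyps by (auto simp: C_def intro: member_le_sum)
    then show "\<forall>j\<in>{..k}. finite (C S (k - j))"
      by (intro ballI finite_subset[OF _ finite_set_of_finite_funs[OF insert.hyps(1) finite_atMost]])
  qed simp
  also have "\<dots> = (\<Sum>a\<in>C (insert s S) k. \<Prod>i\<in>insert s S. x i ^ a i / fact (a i))"
  proof (rule sum.reindex_bij_witness[where i = "\<lambda>a. (a s, a(s := 0))" and j = "\<lambda>(j, a). a(s := j)"])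
    fix p assume "p \<in> (SIGMA j:{..k}. C S (k - j))"
    then obtain j a where p: "p = (j, a)" "j \<le> k" "a \<in> C S (k - j)"
      by auto
    then have "a s = 0"
      using insert.hyps by (simp add: C_def)
    then show "((case p of (j, a) \<Rightarrow> a(s := j)) s, (case p of (j, a) \<Rightarrow> a(s := j))(s := 0)) = p"
      using p by (simp add: fun_upd_idem)
    show "(case p of (j, a) \<Rightarrow> a(s := j)) \<in> C (insert s S) k"
      using p insert.hyps by (simp add: C_def upd del: fun_upd_apply) simp
    have "(\<Prod>i\<in>S. x i ^ (a(s := j)) i / fact ((a(s := j)) i)) = (\<Prod>i\<in>S. x i ^ a i / fact (a i))"
      using insert.hyps by (intro prod.cong) auto
    then show "(\<Prod>i\<in>insert s S. x i ^ (case p of (j, a) \<Rightarrow> a(s := j)) i /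
          fact ((case p of (j, a) \<Rightarrow> a(s := j)) i)) =
        (case p of (j, a) \<Rightarrow> x s ^ j / fact j * (\<Prod>i\<in>S. x i ^ a i / fact (a i)))"
      using p insert.hyps by simp
  next
    fix a assume "a \<in> C (insert s S) k"
    then show "(case (a s, a(s := 0)) of (j, a) \<Rightarrow> a(s := j)) = a"
      and "(a s, a(s := 0)) \<in> (SIGMA j:{..k}. C S (k - j))"
      using insert.hyps upd[of a 0] by (auto simp: C_def)
  qed
  finally show ?case
    unfolding C_def .
qed

theorem multinomial_theorem:
  fixes x :: "'n::finite \<Rightarrow> real"
  shows "(\<Sum>i\<in>UNIV. x i) ^ k = (\<Sum>a\<in>weak_compositions k. multinomial k a * (\<Prod>i\<in>UNIV. x i ^ a i))"
proof -
  have "(\<Sum>i\<in>UNIV. x i) ^ k = fact k * ((\<Sum>i\<in>UNIV. x i) ^ k / fact k)"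
    by simp
  also have "\<dots> = (\<Sum>a\<in>weak_compositions k. fact k * (\<Prod>i\<in>UNIV. x i ^ a i / fact (a i)))"
    by (simp only: divided_power_sum[OF finite] weak_compositions_def sum_distrib_left) simp
  finally show ?thesis
    by (simp add: multinomial_def prod_dividef)
qed

text \<open>
  Expanding the square gives three products of single sums: the two square terms agree after
  exchanging the indices, and the mixed term is the square of one sum.
\<close>
lemma weighted_Lagrange_identity:
  fixes c p q :: "'a \<Rightarrow> 'b::comm_ring_1"
  shows "(\<Sum>(a, b)\<in>A \<times> A. c a * c b * (p a * q b - p b * q a)\<^sup>2) =
    2 * ((\<Sum>a\<in>A. c a * (p a)\<^sup>2) * (\<Sum>a\<in>A. c a * (q a)\<^sup>2) - (\<Sum>a\<in>A. c a * (p a * q a))\<^sup>2)"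
proof -
  let ?P = "\<lambda>a. c a * (p a)\<^sup>2" and ?Q = "\<lambda>a. c a * (q a)\<^sup>2" and ?R = "\<lambda>a. c a * (p a * q a)"
  have "c a * c b * (p a * q b - p b * q a)\<^sup>2 = ?P a * ?Q b + ?Q a * ?P b - 2 * (?R a * ?R b)" for a b
    by (simp add: power2_eq_square algebra_simps)
  then have "(\<Sum>(a, b)\<in>A \<times> A. c a * c b * (p a * q b - p b * q a)\<^sup>2) =
      (\<Sum>a\<in>A. \<Sum>b\<in>A. ?P a * ?Q b + ?Q a * ?P b - 2 * (?R a * ?R b))"
    by (simp add: sum.cartesian_product)
  also have "\<dots> = sum ?P A * sum ?Q A + sum ?Q A * sum ?P A - 2 * (sum ?R A * sum ?R A)"
    by (simp add: sum_subtractf sum.distrib sum_product flip: sum_distrib_left[of 2])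
  finally show ?thesis
    by (simp add: power2_eq_square algebra_simps)
qed

theorem theorem3p5:
  fixes v w :: "real ^ 'n" and k :: nat
  assumes "k \<ge> 1"
  shows "norm v ^ (2 * k) * norm w ^ (2 * k) - (v \<bullet> w) ^ (2 * k) =
    (1 / 2) * (\<Sum>(a, b) \<in> weak_compositions k \<times> weak_compositions k.
      multinomial k a * multinomial k b *
      ((\<Prod>i\<in>UNIV. (v $ i) ^ a i * (w $ i) ^ b i)
        - (\<Prod>i\<in>UNIV. (v $ i) ^ b i * (w $ i) ^ a i))\<^sup>2)"
proof -
  define mono :: "real ^ 'n \<Rightarrow> ('n \<Rightarrow> nat) \<Rightarrow> real"
    where "mono x a = (\<Prod>i\<in>UNIV. (x $ i) ^ a i)" for x a
  have inner: "(x \<bullet> y) ^ k =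
      (\<Sum>a\<in>weak_compositions k. multinomial k a * (mono x a * mono y a))" for x y
    by (simp add: inner_vec_def multinomial_theorem mono_def power_mult_distrib prod.distrib)
  have norm: "norm x ^ (2 * k) = (\<Sum>a\<in>weak_compositions k. multinomial k a * (mono x a)\<^sup>2)" for x
    using inner[of x x] by (simp add: power_mult power2_norm_eq_inner flip: power2_eq_square)
  have "(v \<bullet> w) ^ (2 * k) = ((v \<bullet> w) ^ k)\<^sup>2"
    by (simp add: mult.commute flip: power_mult)
  then show ?thesis
    using weighted_Lagrange_identity[of "multinomial k" "mono v" "mono w" "weak_compositions k"]
    by (simp add: inner norm mono_def prod.distrib)
qed

end
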